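(* Let $P\subset\mathbb R^2$ be an arbitrary polygon, and for a direction $\theta\in S^1$ let $fd_\theta(n)$ be the complexity in direction $\theta$ of the billiard map in $P$. Then for any $\varepsilon>0$ and (Lebesgue) almost every direction $\theta$ we have $fd_\theta(n)=O(n^{1+\varepsilon})$ as $n\to\infty$.
   Context: A polygon $P$ is a compact connected region bounded by finitely many straight sides, not necessarily simply connected. The phase space $X$ of the billiard map $T:X\to X$ consists of oriented straight segments in $P$ with endpoints in $\partial P$ and otherwise not meeting $\partial P$ (equivalently, unit vectors based at boundary points and directed into $P$); $T$ sends a segment to the next segment of the billiard trajectory after reflection at the side where it ends. $Tx$ is not defined if the segment $x$ ends at a corner. The continuity regions of $T^n$ are the connected components of the set of $x\in X$ (based at interior points of sides) for which $T^nx$ is defined, i.e. none of $x,Tx,\dots,T^{n-1}x$ ends at a corner. For $\theta\in S^1$ let $R_\theta\subset X$ be the set of segments with direction $\theta$. The direction complexity $fd_\theta(n)$ is the number of continuity regions of $T^n$ that intersect $R_\theta$. *)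

theory Defs
  imports "HOL-Analysis.Analysis" "HOL-Library.Landau_Symbols"
begin

text \<open>
  The Euclidean plane is \<^typ>\<open>complex\<close>.  A polygon is a region \<open>P\<close> together with a finite set \<open>S\<close>
  of sides, a side being the pair of its end points.  Distinct sides meet at most in common
  end points.  Neither \<open>P\<close> nor its boundary is assumed to be simple: there may be holes, the
  boundary may touch itself at corners, and angles equal to \<open>\<pi>\<close> are allowed at corners.
\<close>

definition polygon :: "complex set \<Rightarrow> (complex \<times> complex) set \<Rightarrow> bool" where
  "polygon P S \<longleftrightarrow>
     compact P \<and> connected P \<and> interior P \<noteq> {} \<and> P = closure (interior P) \<and>
     finite S \<and> (\<forall>(a, b)\<in>S. a \<noteq> b) \<and>
     frontier P = (\<Union>(a, b)\<in>S. closed_segment a b) \<and>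
     (\<forall>(a, b)\<in>S. \<forall>(c, d)\<in>S. (a, b) \<noteq> (c, d) \<longrightarrow> open_segment a b \<inter> closed_segment c d = {})"

definition corners :: "(complex \<times> complex) set \<Rightarrow> complex set" where
  "corners S = fst ` S \<union> snd ` S"

text \<open>
  The oriented segment starting at \<open>p\<close> in the direction of the unit vector \<open>v\<close> is represented by
  \<open>(p, v)\<close>; the phase space carries the subspace topology of the product.
\<close>

definition phase_space :: "complex set \<Rightarrow> (complex \<times> complex) set" where
  "phase_space P =
     {(p, v). p \<in> frontier P \<and> norm v = 1 \<and> (\<forall>\<^sub>F t in at_right 0. p + t *\<^sub>R v \<in> interior P)}"

text \<open>
  On \<^term>\<open>phase_space P\<close>, for compact \<open>P\<close>, the infimum below is a positive minimum: the length
  of the segment.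
\<close>

definition end_point :: "complex set \<Rightarrow> complex \<times> complex \<Rightarrow> complex" where
  "end_point P = (\<lambda>(p, v). p + Inf {t. 0 < t \<and> p + t *\<^sub>R v \<in> frontier P} *\<^sub>R v)"

definition reflect :: "complex \<times> complex \<Rightarrow> complex \<Rightarrow> complex" where
  "reflect = (\<lambda>(a, b) v. (2 * (v \<bullet> (b - a)) / ((b - a) \<bullet> (b - a))) *\<^sub>R (b - a) - v)"

text \<open>
  The value of this total function is meaningful only if the segment does not end at a corner;
  it is used only in this case.
\<close>

definition billiard_map ::
  "complex set \<Rightarrow> (complex \<times> complex) set \<Rightarrow> complex \<times> complex \<Rightarrow> complex \<times> complex" where
  "billiard_map P S x =
     (let q = end_point P x;
          s = (THE s. s \<in> S \<and> q \<in> open_segment (fst s) (snd s))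
      in (q, reflect s (snd x)))"

text \<open>The points based at interior points of sides at which the \<open>n\<close>-th iterate is defined.\<close>

definition iterate_domain ::
  "complex set \<Rightarrow> (complex \<times> complex) set \<Rightarrow> nat \<Rightarrow> (complex \<times> complex) set" where
  "iterate_domain P S n =
     {x \<in> phase_space P. fst x \<notin> corners S \<and>
        (\<forall>k<n. end_point P ((billiard_map P S ^^ k) x) \<notin> corners S)}"

definition continuity_regions ::
  "complex set \<Rightarrow> (complex \<times> complex) set \<Rightarrow> nat \<Rightarrow> (complex \<times> complex) set set" where
  "continuity_regions P S n = components (iterate_domain P S n)"

definition direction_set :: "complex set \<Rightarrow> complex \<Rightarrow> (complex \<times> complex) set" where
  "direction_set P \<theta> = {x \<in> phase_space P. snd x = \<theta>}"

definition direction_regions ::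
  "complex set \<Rightarrow> (complex \<times> complex) set \<Rightarrow> complex \<Rightarrow> nat \<Rightarrow> (complex \<times> complex) set set" where
  "direction_regions P S \<theta> n = {C \<in> continuity_regions P S n. C \<inter> direction_set P \<theta> \<noteq> {}}"

definition direction_complexity ::
  "complex set \<Rightarrow> (complex \<times> complex) set \<Rightarrow> complex \<Rightarrow> nat \<Rightarrow> nat" where
  "direction_complexity P S \<theta> n = card (direction_regions P S \<theta> n)"

end

theory Submission
  imports Defs
begin

text \<open>In a fixed direction, two points of a side lie in the same region unless a point between them
  is singular, i.e. its orbit runs into a corner, so it suffices to count singular points. By
  reversibility of the billiard, the points whose orbit hits a corner at step \<open>k\<close> correspond to rays
  leaving the corners. Along such rays the map from the initial direction to the direction after
  \<open>k\<close> reflections is piecewise a rotation or reflection of the circle, so the number \<open>g k t\<close> of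
  singular points of step \<open>k\<close> in direction \<open>cis t\<close> has locally in \<open>t\<close> an integral bounded
  independently of \<open>k\<close>. Hence \<open>\<Sum>k. g k t / (k + 1) powr (1 + \<epsilon>)\<close> is finite for almost every \<open>t\<close>.\<close>

section \<open>Tools from plane geometry, topology and integration\<close>

text \<open>In complex form a reflection is conjugation followed by a unimodular factor, so iterated
  reflections merely accumulate such factors.\<close>

lemma reflect_eq:
  assumes "a \<noteq> b"
  shows "reflect (a, b) v = (b - a) / cnj (b - a) * cnj v"
proof -
  define d where "d = b - a"
  have d: "d \<noteq> 0" "cnj d \<noteq> 0" using assms by (auto simp: d_def)
  have dd: "complex_of_real (d \<bullet> d) = d * cnj d"
    by (metis complex_norm_square dot_square_norm of_real_power)
  have vd: "complex_of_real (2 * (v \<bullet> d)) = v * cnj d + cnj v * d"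
    by (simp add: complex_eq_iff inner_complex_def algebra_simps)
  have "reflect (a, b) v = (v * cnj d + cnj v * d) / (d * cnj d) * d - v"
    unfolding reflect_def by (simp add: scaleR_conv_of_real d_def[symmetric] dd[symmetric] vd[symmetric])
  also have "\<dots> = d / cnj d * cnj v"
    using d by (simp add: field_simps)
  finally show ?thesis by (simp add: d_def)
qed

text \<open>A connected set meeting both \<open>P\<close> and its complement would cross the
  frontier. This converts missing the frontier into lying inside.\<close>

lemma connected_subset_interior:
  fixes P :: "'a::topological_space set"
  assumes "connected H" "H \<inter> frontier P = {}" "H \<inter> interior P \<noteq> {}"
  shows "H \<subseteq> interior P"
proof -
  have "H - P = {}"
    using connected_Int_frontier[of H P] assms interior_subset by blast
  then show ?thesis
    using assms(2) closure_subset unfolding frontier_def by blast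
qed

lemma Im_scaleR_divide: "Im (c *\<^sub>R z / d) = c * Im (z / d)"
proof -
  have "c *\<^sub>R z / d = c *\<^sub>R (z / d)" by (simp add: scaleR_conv_of_real)
  then show ?thesis by simp
qed

text \<open>For nonzero \<open>s\<close> and \<open>d\<close> this is an open half plane bounded by
  the line through 0 along \<open>d\<close>; the sign of \<open>s\<close> selects the half.\<close>

lemma convex_half_plane: "convex {w. 0 < s * Im (w / d)}"
proof (rule convexI)
  fix x y u v assume *: "x \<in> {w. 0 < s * Im (w / d)}" "y \<in> {w. 0 < s * Im (w / d)}" "0 \<le> u" "0 \<le> v" "u + v = (1::real)"
  have "s * Im ((u *\<^sub>R x + v *\<^sub>R y) / d) = u * (s * Im (x / d)) + v * (s * Im (y / d))"
    by (simp add: add_divide_distrib Im_scaleR_divide algebra_simps)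
  moreover have "\<dots> > 0"
    using * by (cases "u = 0") (auto intro: add_pos_nonneg)
  ultimately show "u *\<^sub>R x + v *\<^sub>R y \<in> {w. 0 < s * Im (w / d)}" by simp
qed

text \<open>Projecting a closed set along a compact factor keeps it closed. This is the source of
  all measurability statements about rays below.\<close>

lemma closed_ray_hits:
  fixes K :: "'a::euclidean_space set"
  assumes "compact I" "closed K"
  shows "closed {x::'a \<times> 'a. \<exists>t\<in>I. fst x + t *\<^sub>R snd x \<in> K}"
proof -
  have "closed ((\<lambda>y. fst (snd y) + fst y *\<^sub>R snd (snd y)) -` K :: (real \<times> 'a \<times> 'a) set)"
    by (intro continuous_closed_vimage assms) (auto intro!: continuous_intros)
  from closed_compact_projection[OF assms(1) this] show ?thesis
    by (simp add: Bex_def)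
qed

text \<open>The substitution is an isometry of the line that carries \<open>{-m..m}\<close> into
  \<open>{-(m + r)..m + r}\<close>.\<close>

lemma nn_integral_indicator_affine_le:
  fixes A :: "real set"
  assumes A: "A \<in> sets borel" and \<sigma>: "\<bar>\<sigma>\<bar> = 1" and a: "\<bar>a\<bar> \<le> r"
  shows "(\<integral>\<^sup>+t. indicator A (\<sigma> * (t + a)) * indicator {-m..m} t \<partial>lborel)
    \<le> emeasure lborel (A \<inter> {-(m + r)..m + r})"
proof -
  let ?f = "indicator (A \<inter> {-(m + r)..m + r}) :: real \<Rightarrow> ennreal"
  have \<sigma>': "\<sigma> = 1 \<or> \<sigma> = -1" using \<sigma> by linarith
  have "(\<integral>\<^sup>+t. indicator A (\<sigma> * (t + a)) * indicator {-m..m} t \<partial>lborel)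
      \<le> (\<integral>\<^sup>+t. ?f (\<sigma> * a + \<sigma> * t) \<partial>lborel)"
    using a \<sigma>' by (intro nn_integral_mono) (auto split: split_indicator simp: algebra_simps)
  also have "\<dots> = (\<integral>\<^sup>+t. ?f t \<partial>lborel)"
    using nn_integral_real_affine[of ?f \<sigma> "\<sigma> * a"] A \<sigma> by fastforce
  also have "\<dots> = emeasure lborel (A \<inter> {-(m + r)..m + r})"
    using A by (intro nn_integral_indicator) auto
  finally show ?thesis .
qed

text \<open>The function \<open>\<Sum>k. g k / (k + 1) powr (1 + \<epsilon>)\<close> is locally integrable, hence finite almost
  everywhere, and it dominates \<open>n powr -(1 + \<epsilon>)\<close> times the \<open>n\<close>-th partial sum.\<close>

lemma AE_partial_sums_powr:
  fixes g :: "nat \<Rightarrow> real \<Rightarrow> real" and \<epsilon> :: real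
  assumes \<epsilon>: "\<epsilon> > 0" and g0: "\<And>k t. 0 \<le> g k t"
    and meas [measurable]: "\<And>k. g k \<in> borel_measurable borel"
    and bound: "\<And>m k. (\<integral>\<^sup>+t. ennreal (g k t) * indicator {-m..m} t \<partial>lborel) \<le> ennreal (c m)"
  shows "AE t in lborel. \<exists>K\<ge>0. \<forall>n. (\<Sum>k<n. g k t) \<le> K * real n powr (1 + \<epsilon>)"
proof -
  \<comment> \<open>The shift to \<open>Suc k\<close> makes every weight positive and, for
    \<open>k < n\<close>, at least \<open>n powr - (1 + \<epsilon>)\<close>.\<close>
  define w where "w k = real (Suc k) powr - (1 + \<epsilon>)" for k
  have w0: "0 < w k" for k by (simp add: w_def)
  have sw: "summable w"
    using summable_real_powr_iff[of "- (1 + \<epsilon>)"] \<epsilon>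
    unfolding w_def by (subst summable_Suc_iff[of "\<lambda>k. real k powr - (1 + \<epsilon>)"]) simp
  \<comment> \<open>The integral bounds are local, so finiteness is shown on each bounded interval
    and then for all natural \<open>m\<close> at once.\<close>
  have "AE t in lborel. t \<in> {-real m..real m} \<longrightarrow> (\<Sum>k. ennreal (w k * g k t)) \<noteq> \<infinity>" for m :: nat
  proof -
    let ?I = "indicator {-real m..real m} :: real \<Rightarrow> ennreal"
    have "(\<integral>\<^sup>+t. (\<Sum>k. ennreal (w k) * (ennreal (g k t) * ?I t)) \<partial>lborel)
        = (\<Sum>k. ennreal (w k) * (\<integral>\<^sup>+t. ennreal (g k t) * ?I t \<partial>lborel))"
      by (simp add: nn_integral_suminf nn_integral_cmult)
    also have "\<dots> \<le> (\<Sum>k. ennreal (w k) * ennreal (c (real m)))"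
      by (intro suminf_le mult_left_mono bound) auto
    also have "\<dots> = (\<Sum>k. ennreal (w k)) * ennreal (c (real m))" by simp
    also have "\<dots> < \<infinity>"
      using sw w0 by (simp add: suminf_ennreal2 less_imp_le ennreal_mult_less_top)
    finally have "AE t in lborel. (\<Sum>k. ennreal (w k) * (ennreal (g k t) * ?I t)) \<noteq> \<infinity>"
      by (intro nn_integral_PInf_AE) auto
    then show ?thesis
    proof eventually_elim
      case (elim t)
      then show ?case using w0 g0 by (intro impI) (simp add: ennreal_mult less_imp_le)
    qed
  qed
  then have "AE t in lborel. \<forall>m::nat. t \<in> {-real m..real m} \<longrightarrow> (\<Sum>k. ennreal (w k * g k t)) \<noteq> \<infinity>"
    by (subst AE_all_countable) blast
  then show ?thesis
  proof eventually_elim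
    case (elim t)
    obtain m :: nat where "\<bar>t\<bar> \<le> real m" using real_arch_simple by blast
    then have "(\<Sum>k. ennreal (w k * g k t)) \<noteq> top" using elim[rule_format, of m] by (simp add: abs_le_iff)
    then have sm: "summable (\<lambda>k. w k * g k t)"
      by (intro summable_suminf_not_top mult_nonneg_nonneg g0 less_imp_le[OF w0])
    have p: "0 \<le> w k * g k t" for k using w0[of k] g0[of k t] by simp
    show ?case
    proof (intro exI[of _ "\<Sum>k. w k * g k t"] conjI allI)
      show "0 \<le> (\<Sum>k. w k * g k t)" by (intro suminf_nonneg sm p)
      fix n
      have "(\<Sum>k<n. g k t) \<le> (\<Sum>k<n. real n powr (1 + \<epsilon>) * (w k * g k t))"
      proof (rule sum_mono)
        fix k assume "k \<in> {..<n}"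
        then have "real (Suc k) powr (1 + \<epsilon>) \<le> real n powr (1 + \<epsilon>)"
          using \<epsilon> by (intro powr_mono2) auto
        then have "real (Suc k) powr (1 + \<epsilon>) * w k \<le> real n powr (1 + \<epsilon>) * w k"
          using w0[of k] by (intro mult_right_mono) auto
        moreover have "real (Suc k) powr (1 + \<epsilon>) * w k = 1"
          unfolding w_def by (subst powr_add[symmetric]) simp
        ultimately have "1 * g k t \<le> real n powr (1 + \<epsilon>) * w k * g k t"
          using g0[of k t] by (intro mult_right_mono) auto
        then show "g k t \<le> real n powr (1 + \<epsilon>) * (w k * g k t)" by (simp add: mult.assoc)
      qed
      also have "\<dots> = real n powr (1 + \<epsilon>) * (\<Sum>k<n. w k * g k t)" by (simp add: sum_distrib_left)
      also have "\<dots> \<le> real n powr (1 + \<epsilon>) * (\<Sum>k. w k * g k t)"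
        by (intro mult_left_mono sum_le_suminf sm p) auto
      finally show "(\<Sum>k<n. g k t) \<le> (\<Sum>k. w k * g k t) * real n powr (1 + \<epsilon>)"
        by (simp add: mult.commute)
    qed
  qed
qed

section \<open>Sides of the table and vectors pointing into it\<close>

locale polygon_table =
  fixes P :: "complex set" and S :: "(complex \<times> complex) set"
  assumes poly: "polygon P S"
begin

abbreviation "X \<equiv> phase_space P"
abbreviation "T \<equiv> billiard_map P S"

lemma
  shows compact_P: "compact P" and finite_S: "finite S"
    and side_neq: "(a, b) \<in> S \<Longrightarrow> a \<noteq> b"
    and frontier_P: "frontier P = (\<Union>(a, b)\<in>S. closed_segment a b)"
    and sides_disjoint: "(a, b) \<in> S \<Longrightarrow> (c, d) \<in> S \<Longrightarrow> (a, b) \<noteq> (c, d) \<Longrightarrow>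
      open_segment a b \<inter> closed_segment c d = {}"
  using poly unfolding polygon_def by (simp_all add: case_prod_unfold) (fastforce+)?

lemma finite_corners: "finite (corners S)"
  by (simp add: corners_def finite_S)

lemma open_side_frontier: "(a, b) \<in> S \<Longrightarrow> p \<in> open_segment a b \<Longrightarrow> p \<in> frontier P"
  unfolding frontier_P using open_closed_segment by fastforce

lemma open_side_not_corner:
  assumes "(a, b) \<in> S" "p \<in> open_segment a b" shows "p \<notin> corners S"
proof
  assume "p \<in> corners S"
  then obtain c d where cd: "(c, d) \<in> S" "p = c \<or> p = d" unfolding corners_def by fastforce
  show False
  proof (cases "(a, b) = (c, d)")
    case True then show False using assms cd by (auto simp: open_segment_def)
  next
    case False then show False using sides_disjoint[OF assms(1) cd(1) False] assms cd by auto
  qed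
qed

lemma frontier_not_corner:
  assumes "p \<in> frontier P" "p \<notin> corners S"
  obtains a b where "(a, b) \<in> S" "p \<in> open_segment a b"
proof -
  from assms(1) obtain a b where "(a, b) \<in> S" "p \<in> closed_segment a b"
    unfolding frontier_P by blast
  moreover from this(1) have "a \<in> corners S" "b \<in> corners S" by (force simp: corners_def)+
  ultimately show ?thesis using assms(2) that by (auto simp: open_segment_def)
qed

text \<open>Distinct open sides are disjoint, so the definite description in
  \<open>billiard_map\<close> denotes the side that is hit.\<close>

lemma the_side:
  assumes "(a, b) \<in> S" "p \<in> open_segment a b"
  shows "(THE s. s \<in> S \<and> p \<in> open_segment (fst s) (snd s)) = (a, b)"
proof (rule the_equality)
  fix s assume "s \<in> S \<and> p \<in> open_segment (fst s) (snd s)"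
  then show "s = (a, b)"
    using assms sides_disjoint[of a b "fst s" "snd s"] open_closed_segment by fastforce
qed (use assms in auto)

text \<open>Near an open side, \<open>P\<close> lies on the same side of the line all along the segment: a
  thin half-neighbourhood of a subsegment is convex and misses the frontier.\<close>

lemma phase_space_side:
  assumes s: "(a, b) \<in> S" and p: "p \<in> open_segment a b" "p' \<in> open_segment a b"
    and pu: "(p, u) \<in> X" and u': "norm u' = 1" and pos: "Im (u / (b - a)) * Im (u' / (b - a)) > 0"
  shows "(p', u') \<in> X"
proof -
  define d where "d = b - a"
  define K where "K = closed_segment p p'"
  define F where "F = (\<Union>(c, e)\<in>S - {(a, b)}. closed_segment c e)"
  define r where "r = Im (u / d)"
  have d: "d \<noteq> 0" using side_neq[OF s] by (simp add: d_def)
  have K: "K \<subseteq> open_segment a b"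
    unfolding K_def using p by (simp add: closed_segment_subset)
  have "closed F" unfolding F_def using finite_S by (auto intro!: closed_UN)
  moreover have "K \<inter> F = {}"
    unfolding F_def using K sides_disjoint[OF s] by fastforce
  moreover have "compact K" unfolding K_def by simp
  ultimately obtain \<delta> where \<delta>: "\<delta> > 0" "\<And>x y. x \<in> K \<Longrightarrow> y \<in> F \<Longrightarrow> \<delta> \<le> dist x y"
    using separate_compact_closed[of K F] by blast
  \<comment> \<open>Short vectors on the same side of the line as \<open>u\<close>: their length
    keeps \<open>z + w\<close> off the other sides, their nonzero imaginary part keeps it off
    \<open>(a, b)\<close>.\<close>
  define W where "W = ball 0 \<delta> \<inter> {w. 0 < r * Im (w / d)}"
  define H where "H = (\<Union>z\<in>K. \<Union>w\<in>W. {z + w})"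
  have "convex H"
    unfolding H_def W_def K_def
    by (intro convex_sums convex_Int convex_ball convex_half_plane convex_closed_segment)
  then have conn: "connected H" by (rule convex_connected)
  have on_line: "Im ((z - a) / d) = 0" if z: "z \<in> closed_segment a b" for z
  proof -
    obtain c where "z = (1 - c) *\<^sub>R a + c *\<^sub>R b" using z by (auto simp: closed_segment_def)
    then have "z - a = c *\<^sub>R d" by (simp add: d_def algebra_simps)
    then show ?thesis using d by (simp add: Im_scaleR_divide)
  qed
  have "H \<inter> frontier P = {}"
  proof (rule ccontr)
    assume "H \<inter> frontier P \<noteq> {}"
    then obtain z w where zw: "z \<in> K" "w \<in> W" "z + w \<in> frontier P" unfolding H_def by blast
    have "z + w \<notin> F"
      using \<delta>(2)[OF zw(1), of "z + w"] zw(2) by (auto simp: W_def dist_norm)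
    then have "z + w \<in> closed_segment a b"
      using zw(3) unfolding frontier_P F_def by blast
    moreover have "z \<in> closed_segment a b" using K zw(1) open_closed_segment by blast
    ultimately have "Im ((z + w - a) / d) - Im ((z - a) / d) = 0" using on_line by simp
    then have "Im (w / d) = 0" by (simp add: diff_divide_distrib add_divide_distrib)
    then show False using zw(2) by (simp add: W_def)
  qed
  moreover have near: "\<forall>\<^sub>F t in at_right 0. q + t *\<^sub>R e \<in> H"
    if "q \<in> K" "norm e = 1" "r * Im (e / d) > 0" for q e
  proof -
    have "q + t *\<^sub>R e \<in> H" if "0 < t" "t < \<delta>" for t
    proof -
      have "t *\<^sub>R e \<in> W"
        using that \<open>norm e = 1\<close> \<open>r * Im (e / d) > 0\<close>
        by (simp add: W_def Im_scaleR_divide mult.left_commute[of r])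
      then show ?thesis using \<open>q \<in> K\<close> unfolding H_def by blast
    qed
    then show ?thesis using \<delta>(1) unfolding eventually_at_right_field by blast
  qed
  moreover have "H \<inter> interior P \<noteq> {}"
  proof -
    have "r \<noteq> 0" using pos by (auto simp: r_def d_def)
    then have "\<forall>\<^sub>F t in at_right 0. p + t *\<^sub>R u \<in> H"
      using pu by (intro near) (auto simp: K_def phase_space_def r_def zero_less_mult_iff linorder_neq_iff)
    moreover have "\<forall>\<^sub>F t in at_right 0. p + t *\<^sub>R u \<in> interior P"
      using pu by (simp add: phase_space_def)
    ultimately have "\<forall>\<^sub>F t in at_right 0. p + t *\<^sub>R u \<in> H \<inter> interior P"
      by eventually_elim auto
    then have "\<exists>t::real. p + t *\<^sub>R u \<in> H \<inter> interior P"
      by (rule eventually_happens'[OF trivial_limit_at_right_real])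
    then show ?thesis by blast
  qed
  ultimately have "H \<subseteq> interior P" using connected_subset_interior[OF conn] by blast
  moreover have "\<forall>\<^sub>F t in at_right 0. p' + t *\<^sub>R u' \<in> H"
    using u' pos by (intro near) (auto simp: K_def r_def d_def)
  ultimately have "\<forall>\<^sub>F t in at_right 0. p' + t *\<^sub>R u' \<in> interior P"
    by (auto elim: eventually_mono)
  then show ?thesis using open_side_frontier[OF s p(2)] u' by (simp add: phase_space_def)
qed

text \<open>A vector parallel to the side would stay in the open side for a short time, hence in the
  frontier instead of the interior.\<close>

lemma phase_space_transversal:
  assumes s: "(a, b) \<in> S" and p: "p \<in> open_segment a b" and pu: "(p, u) \<in> X"
  shows "Im (u / (b - a)) \<noteq> 0"
proof
  assume *: "Im (u / (b - a)) = 0"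
  have ab: "a \<noteq> b" by (rule side_neq[OF s])
  define c where "c = Re (u / (b - a))"
  have "u / (b - a) = of_real c" using * by (simp add: c_def complex_eq_iff)
  then have u: "u = c *\<^sub>R (b - a)" using ab by (simp add: field_simps scaleR_conv_of_real)
  obtain m where m: "0 < m" "m < 1" "p = (1 - m) *\<^sub>R a + m *\<^sub>R b"
    using p by (auto simp: in_segment)
  have "((\<lambda>t. m + t * c) \<longlongrightarrow> m + 0 * c) (at_right 0)" by (intro tendsto_intros)
  then have "\<forall>\<^sub>F t in at_right 0. 0 < m + t * c" "\<forall>\<^sub>F t in at_right 0. m + t * c < 1"
    using m by (auto dest: order_tendstoD)
  moreover have "\<forall>\<^sub>F t in at_right 0. p + t *\<^sub>R u \<in> interior P"
    using pu by (simp add: phase_space_def)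
  ultimately have "\<forall>\<^sub>F t::real in at_right 0. False"
  proof eventually_elim
    case (elim t)
    have "p + t *\<^sub>R u = (1 - (m + t * c)) *\<^sub>R a + (m + t * c) *\<^sub>R b"
      unfolding u m(3) by (simp add: algebra_simps)
    then have "p + t *\<^sub>R u \<in> open_segment a b" using elim ab unfolding in_segment by blast
    then have "p + t *\<^sub>R u \<in> frontier P" by (rule open_side_frontier[OF s])
    then show False using elim by (simp add: frontier_def)
  qed
  then show False by (simp add: trivial_limit_at_right_real)
qed

section \<open>Free flight, and the billiard map as a product of two involutions\<close>

definition flight :: "complex \<times> complex \<Rightarrow> real" where
  "flight x = Inf {t. 0 < t \<and> fst x + t *\<^sub>R snd x \<in> frontier P}"

lemma end_point_flight: "end_point P x = fst x + flight x *\<^sub>R snd x"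
  by (cases x) (simp add: end_point_def flight_def)

text \<open>The hitting times form a nonempty closed set bounded below, so the infimum is attained;
  before it the ray cannot leave the interior.\<close>

lemma flight:
  assumes "x \<in> X"
  shows "0 < flight x" and "end_point P x \<in> frontier P"
    and "\<And>t. 0 < t \<Longrightarrow> t < flight x \<Longrightarrow> fst x + t *\<^sub>R snd x \<in> interior P"
proof -
  define p v where "p = fst x" and "v = snd x"
  define A where "A = {t. 0 < t \<and> p + t *\<^sub>R v \<in> frontier P}"
  have L: "flight x = Inf A" by (simp add: flight_def A_def p_def v_def)
  have v: "norm v = 1" and "\<forall>\<^sub>F t in at_right 0. p + t *\<^sub>R v \<in> interior P"
    using assms by (auto simp: phase_space_def p_def v_def)
  then obtain c where c: "c > 0" "\<And>t. 0 < t \<Longrightarrow> t < c \<Longrightarrow> p + t *\<^sub>R v \<in> interior P"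
    unfolding eventually_at_right_field by auto
  have int_fr: "y \<notin> frontier P" if "y \<in> interior P" for y
    using that by (simp add: frontier_def)
  \<comment> \<open>Replacing the strict bound \<open>0 < t\<close> by \<open>c \<le> t\<close> is
    what makes \<open>A\<close> closed.\<close>
  have Ac: "A = {t. c \<le> t \<and> p + t *\<^sub>R v \<in> frontier P}"
    using c int_fr unfolding A_def by force
  have conn: "connected ((\<lambda>t. p + t *\<^sub>R v) ` I)" if "connected I" for I :: "real set"
    by (intro connected_continuous_image continuous_intros that)
  have "A \<noteq> {}"
  proof
    assume "A = {}"
    then have "(\<lambda>t. p + t *\<^sub>R v) ` {0<..} \<inter> frontier P = {}" by (auto simp: A_def)
    moreover have "p + (c/2) *\<^sub>R v \<in> (\<lambda>t. p + t *\<^sub>R v) ` {0<..} \<inter> interior P"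
      using c by auto
    ultimately have sub: "(\<lambda>t. p + t *\<^sub>R v) ` {0<..} \<subseteq> interior P"
      by (intro connected_subset_interior conn) (auto simp: connected_Ioi)
    obtain B where B: "B > 0" "\<And>y. y \<in> P \<Longrightarrow> norm y \<le> B"
      using compact_P compact_imp_bounded bounded_pos by metis
    \<comment> \<open>At this parameter the ray has norm at least \<open>B + 1\<close>, so it has
      left \<open>P\<close>.\<close>
    have "B + norm p + 1 \<in> {0<..}" using B(1) by (simp add: add_pos_nonneg)
    then have "p + (B + norm p + 1) *\<^sub>R v \<in> P" using sub interior_subset by blast
    then have "norm (p + (B + norm p + 1) *\<^sub>R v) \<le> B" by (rule B(2))
    moreover have "norm ((B + norm p + 1) *\<^sub>R v) \<le> norm (p + (B + norm p + 1) *\<^sub>R v) + norm p"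
      by (metis add_diff_cancel_left' norm_triangle_ineq4)
    ultimately show False using v B(1) by simp
  qed
  moreover have "closed A"
  proof -
    have "A = {c..} \<inter> (\<lambda>t. p + t *\<^sub>R v) -` frontier P" by (auto simp: Ac)
    then show ?thesis
      by (auto intro!: continuous_closed_vimage continuous_intros closed_Int)
  qed
  moreover have bdd: "bdd_below A" by (auto simp: A_def bdd_below_def intro: less_imp_le)
  ultimately have "Inf A \<in> A" using closed_contains_Inf by blast
  then show pos: "0 < flight x" and "end_point P x \<in> frontier P"
    by (auto simp: L A_def end_point_flight p_def v_def)
  have "(\<lambda>t. p + t *\<^sub>R v) ` {0<..<Inf A} \<subseteq> interior P"
  proof (intro connected_subset_interior conn)
    show "(\<lambda>t. p + t *\<^sub>R v) ` {0<..<Inf A} \<inter> frontier P = {}"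
      using cInf_lower[OF _ bdd] by (force simp: A_def)
    have "p + (min c (Inf A) / 2) *\<^sub>R v \<in> (\<lambda>t. p + t *\<^sub>R v) ` {0<..<Inf A} \<inter> interior P"
      using c pos L by (intro IntI imageI c(2)) auto
    then show "(\<lambda>t. p + t *\<^sub>R v) ` {0<..<Inf A} \<inter> interior P \<noteq> {}" by blast
  qed auto
  then show "fst x + t *\<^sub>R snd x \<in> interior P" if "0 < t" "t < flight x" for t
    using that unfolding image_subset_iff L p_def v_def by simp
qed

definition reversal :: "complex \<times> complex \<Rightarrow> complex \<times> complex" where
  "reversal x = (end_point P x, - snd x)"

text \<open>Walked backwards, the segment stays inside until parameter \<open>L\<close>, where it
  meets the frontier at the old base point; both flights thus have the same length.\<close>

lemma
  assumes "x \<in> X"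
  shows reversal_phase_space: "reversal x \<in> X" and reversal_reversal: "reversal (reversal x) = x"
proof -
  define L where "L = flight x"
  note F = flight[OF assms, folded L_def]
  have pt: "end_point P x + t *\<^sub>R (- snd x) = fst x + (L - t) *\<^sub>R snd x" for t
    by (simp add: end_point_flight L_def algebra_simps)
  have int: "end_point P x + t *\<^sub>R (- snd x) \<in> interior P" if "0 < t" "t < L" for t
    unfolding pt using F(3)[of "L - t"] that by simp
  then have "\<forall>\<^sub>F t in at_right 0. end_point P x + t *\<^sub>R (- snd x) \<in> interior P"
    using F(1) unfolding eventually_at_right_field by blast
  then show "reversal x \<in> X"
    using assms F(2) unfolding reversal_def by (auto simp: phase_space_def)
  have "fst x \<in> frontier P" using assms by (auto simp: phase_space_def)
  then have "flight (reversal x) = L"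
    unfolding flight_def
  proof (intro cInf_eq_minimum, goal_cases)
    case 1
    then show ?case using F(1) pt[of L] by (simp add: reversal_def)
  next
    case (2 t)
    then show ?case using int[of t] by (force simp: reversal_def frontier_def)
  qed
  then show "reversal (reversal x) = x"
    using pt[of L] by (simp add: reversal_def end_point_flight[of "(end_point P x, - snd x)"])
qed

text \<open>The sign makes \<open>bounce\<close> on an open side the mirror image in the normal of
  that side, so inward vectors stay inward.\<close>

definition bounce :: "complex \<times> complex \<Rightarrow> complex \<times> complex" where
  "bounce = (\<lambda>(q, v). (q, reflect (THE s. s \<in> S \<and> q \<in> open_segment (fst s) (snd s)) (- v)))"

lemma billiard_map_eq: "T x = bounce (reversal x)"
  by (simp add: billiard_map_def bounce_def reversal_def Let_def)

lemma bounce_side: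
  assumes "(a, b) \<in> S" "q \<in> open_segment a b"
  shows "bounce (q, v) = (q, - ((b - a) / cnj (b - a) * cnj v))"
  using assms by (simp add: bounce_def the_side reflect_eq side_neq)

lemma
  assumes x: "x \<in> X" "fst x \<notin> corners S"
  shows bounce_bounce: "bounce (bounce x) = x" and bounce_phase_space: "bounce x \<in> X"
proof -
  obtain q v where qv: "x = (q, v)" by fastforce
  have "q \<in> frontier P" using x by (simp add: qv phase_space_def)
  with x obtain a b where ab: "(a, b) \<in> S" "q \<in> open_segment a b"
    by (auto simp: qv elim: frontier_not_corner)
  define d where "d = b - a"
  have d: "d \<noteq> 0" using side_neq[OF ab(1)] by (simp add: d_def)
  define w where "w = - (d / cnj d * cnj v)"
  have b: "bounce x = (q, w)" by (simp add: qv bounce_side[OF ab] w_def d_def)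
  have "- (d / cnj d * cnj w) = v" using d by (simp add: w_def)
  then show "bounce (bounce x) = x"
    unfolding b bounce_side[OF ab, folded d_def] by (simp add: qv)
  \<comment> \<open>Negated conjugation keeps the imaginary part, so \<open>w\<close> points to the
    same side of the line as \<open>v\<close> and \<open>phase_space_side\<close> applies.\<close>
  have "w / d = - cnj (v / d)"
    using d by (simp add: w_def)
  then have "Im (v / d) * Im (w / d) = (Im (v / d))\<^sup>2"
    by (simp only: power2_eq_square uminus_complex.sel cnj.sel minus_minus)
  also have "\<dots> > 0"
    using phase_space_transversal[OF ab] x by (simp add: qv d_def)
  finally have "Im (v / (b - a)) * Im (w / (b - a)) > 0" unfolding d_def .
  moreover have "norm w = 1"
    using x d by (simp add: w_def norm_mult norm_divide qv phase_space_def)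
  ultimately show "bounce x \<in> X"
    unfolding b using x ab by (auto simp: qv intro: phase_space_side[OF ab(1,2,2), of v])
qed

lemma fst_reversal [simp]: "fst (reversal x) = end_point P x"
  and snd_reversal [simp]: "snd (reversal x) = - snd x"
  by (simp_all add: reversal_def)

lemma fst_billiard_map [simp]: "fst (T x) = end_point P x"
  by (simp add: billiard_map_def Let_def)

lemma billiard_map_phase_space:
  assumes "x \<in> X" "end_point P x \<notin> corners S" shows "T x \<in> X"
  using assms by (simp add: billiard_map_eq bounce_phase_space reversal_phase_space)

text \<open>Since \<open>T\<close> is \<open>reversal\<close> followed by \<open>bounce\<close> and
  both are involutions here, the factors cancel one after the other.\<close>

lemma billiard_map_reversal:
  assumes "x \<in> X" "end_point P x \<notin> corners S"
  shows "T (reversal (T x)) = reversal x"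
  using billiard_map_phase_space[OF assms] assms
  by (simp add: billiard_map_eq[of "reversal (T x)"] reversal_reversal)
    (simp add: billiard_map_eq bounce_bounce reversal_phase_space)

lemma snd_billiard_map:
  assumes "x \<in> X" "end_point P x \<notin> corners S"
  shows "\<exists>(a, b)\<in>S. snd (T x) = (b - a) / cnj (b - a) * cnj (snd x)"
proof -
  obtain a b where ab: "(a, b) \<in> S" "end_point P x \<in> open_segment a b"
    using flight(2)[OF assms(1)] assms(2) by (rule frontier_not_corner)
  then have "snd (T x) = (b - a) / cnj (b - a) * cnj (snd x)"
    unfolding billiard_map_eq reversal_def by (simp add: bounce_side)
  with ab(1) show ?thesis by blast
qed

section \<open>Orbits, their reversal and their directions\<close>

text \<open>Unlike in \<open>iterate_domain\<close>, the base point may be a corner: reversed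
  singular orbits start at corners.\<close>

definition reach :: "nat \<Rightarrow> (complex \<times> complex) set" where
  "reach k = {x \<in> X. \<forall>j<k. end_point P ((T ^^ j) x) \<notin> corners S}"

lemma iterate_domain_eq: "iterate_domain P S k = {x \<in> reach k. fst x \<notin> corners S}"
  by (auto simp: iterate_domain_def reach_def)

lemma reach_Suc: "x \<in> reach (Suc k) \<longleftrightarrow> x \<in> reach k \<and> end_point P ((T ^^ k) x) \<notin> corners S"
  by (auto simp: reach_def less_Suc_eq)

lemma funpow_phase_space: "x \<in> reach k \<Longrightarrow> (T ^^ k) x \<in> X"
  by (induction k) (auto simp: reach_Suc billiard_map_phase_space, simp add: reach_def)

lemma reach_antimono: "x \<in> reach k \<Longrightarrow> j \<le> k \<Longrightarrow> x \<in> reach j"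
  by (simp add: reach_def)

lemma time_reversal:
  assumes x: "x \<in> reach k" and "j \<le> k"
  shows "(T ^^ j) (reversal ((T ^^ k) x)) = reversal ((T ^^ (k - j)) x)"
  using \<open>j \<le> k\<close>
proof (induction j)
  case (Suc j)
  define z where "z = (T ^^ (k - Suc j)) x"
  have z: "z \<in> X" "end_point P z \<notin> corners S"
    using x Suc.prems funpow_phase_space[OF reach_antimono[OF x, of "k - Suc j"]]
    by (simp_all add: z_def reach_def)
  have "k - j = Suc (k - Suc j)" using Suc.prems by simp
  then have "(T ^^ (k - j)) x = T z" by (simp add: z_def)
  then show ?case using Suc billiard_map_reversal[OF z] by (simp add: z_def)
qed simp

text \<open>For \<open>j < k\<close> the \<open>j\<close>-th end point of the orbit of
  \<open>y\<close> is an end point of the orbit of \<open>x\<close> before step \<open>k\<close>,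
  hence not a corner. The second claim recovers \<open>x\<close> from \<open>y\<close>.\<close>

lemma reversed_orbit:
  assumes x: "x \<in> iterate_domain P S k"
  defines "y \<equiv> reversal ((T ^^ k) x)"
  shows "y \<in> reach k" and "x = reversal ((T ^^ k) y)"
proof -
  have x': "x \<in> reach k" "fst x \<notin> corners S" using x by (auto simp: iterate_domain_eq)
  have "end_point P ((T ^^ j) y) \<notin> corners S" if "j < k" for j
  proof -
    have *: "k - j = Suc (k - Suc j)" using that by simp
    have "end_point P ((T ^^ j) y) = fst (reversal (reversal ((T ^^ (k - j)) x)))"
      using that by (simp add: y_def time_reversal[OF x'(1)])
    also have "\<dots> = fst ((T ^^ (k - j)) x)"
      using reach_antimono[OF x'(1), of "k - j"] by (simp add: reversal_reversal funpow_phase_space)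
    also have "\<dots> = end_point P ((T ^^ (k - Suc j)) x)" unfolding * by simp
    finally show ?thesis using x'(1) that by (simp add: reach_def)
  qed
  moreover have "y \<in> X" unfolding y_def by (intro reversal_phase_space funpow_phase_space x')
  ultimately show "y \<in> reach k" by (simp add: reach_def)
  show "x = reversal ((T ^^ k) y)"
    using x'(1) by (simp add: y_def time_reversal reversal_reversal reach_def)
qed

text \<open>After \<open>k\<close> reflections a direction \<open>v\<close> becomes \<open>\<rho> * v\<close> (\<open>k\<close> even) or \<open>\<rho> * cnj v\<close>
  (\<open>k\<close> odd), with finitely many possible factors \<open>\<rho>\<close>.\<close>

primrec slopes :: "nat \<Rightarrow> complex set" where
  "slopes 0 = {1}"
| "slopes (Suc k) = (\<lambda>((a, b), \<rho>). (b - a) / cnj (b - a) * cnj \<rho>) ` (S \<times> slopes k)"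

lemma finite_slopes: "finite (slopes k)"
  by (induction k) (simp_all add: finite_S)

lemma norm_slopes: "\<rho> \<in> slopes k \<Longrightarrow> norm \<rho> = 1"
proof (induction k arbitrary: \<rho>)
  case (Suc k)
  then obtain a b \<sigma> where *: "(a, b) \<in> S" "\<sigma> \<in> slopes k" "\<rho> = (b - a) / cnj (b - a) * cnj \<sigma>"
    by auto
  define d where "d = b - a"
  have "d \<noteq> 0" using side_neq[OF *(1)] by (simp add: d_def)
  then show ?case using Suc.IH[OF *(2)] unfolding *(3) d_def[symmetric]
    by (simp add: norm_mult norm_divide)
qed simp

lemma direction_funpow:
  assumes "(c, cis \<phi>) \<in> reach k"
  shows "\<exists>\<rho>\<in>slopes k. snd ((T ^^ k) (c, cis \<phi>)) = \<rho> * cis ((-1) ^ k * \<phi>)"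
  using assms
proof (induction k)
  case (Suc k)
  then have r: "(c, cis \<phi>) \<in> reach k" "end_point P ((T ^^ k) (c, cis \<phi>)) \<notin> corners S"
    by (auto simp: reach_Suc)
  from Suc.IH[OF r(1)] obtain \<rho> where
    \<rho>: "\<rho> \<in> slopes k" "snd ((T ^^ k) (c, cis \<phi>)) = \<rho> * cis ((-1) ^ k * \<phi>)" by blast
  from snd_billiard_map[OF funpow_phase_space[OF r(1)] r(2)] obtain a b where
    ab: "(a, b) \<in> S" "snd (T ((T ^^ k) (c, cis \<phi>))) = (b - a) / cnj (b - a) * cnj (\<rho> * cis ((-1) ^ k * \<phi>))"
    unfolding \<rho>(2) by blast
  have "(b - a) / cnj (b - a) * cnj \<rho> \<in> slopes (Suc k)" using ab(1) \<rho>(1) by force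
  moreover have "snd ((T ^^ Suc k) (c, cis \<phi>)) = ((b - a) / cnj (b - a) * cnj \<rho>) * cis ((-1) ^ Suc k * \<phi>)"
    using ab(2) by (simp add: cis_cnj)
  ultimately show ?case by blast
qed simp

section \<open>Singular points and their codes\<close>

text \<open>Angles range over the whole line, so the set is invariant under shifts by
  \<open>2 * pi\<close>. For fixed \<open>k\<close> and \<open>c\<close> the angle determines
  \<open>\<rho>\<close>, so distinct slopes give disjoint sets.\<close>

definition emanating :: "nat \<Rightarrow> complex \<Rightarrow> complex \<Rightarrow> real set" where
  "emanating k c \<rho> = {\<phi>. (c, cis \<phi>) \<in> reach k \<and> snd ((T ^^ k) (c, cis \<phi>)) = \<rho> * cis ((-1) ^ k * \<phi>)}"

definition singular_points :: "nat \<Rightarrow> complex \<Rightarrow> (complex \<times> complex) set" where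
  "singular_points k \<theta> =
    {x \<in> iterate_domain P S k. snd x = \<theta> \<and> end_point P ((T ^^ k) x) \<in> corners S}"

text \<open>By time reversal a singular point in direction \<open>cis t\<close> is determined by the corner \<open>c\<close> it
  runs into and the slope \<open>\<rho>\<close> of the unfolding: the angle of the reversed ray at \<open>c\<close> is
  \<open>(-1) ^ k * (t + pi - Arg \<rho>)\<close>.\<close>

definition singular_codes :: "nat \<Rightarrow> real \<Rightarrow> (complex \<times> complex) set" where
  "singular_codes k t =
    {(c, \<rho>) \<in> corners S \<times> slopes k. (-1) ^ k * (t + pi - Arg \<rho>) \<in> emanating k c \<rho>}"

lemma finite_singular_codes: "finite (singular_codes k t)"
  by (rule finite_subset[of _ "corners S \<times> slopes k"])
    (auto simp: singular_codes_def finite_corners finite_slopes)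

lemma singular_points_subset:
  "singular_points k (cis t) \<subseteq>
    (\<lambda>(c, \<rho>). reversal ((T ^^ k) (c, cis ((-1) ^ k * (t + pi - Arg \<rho>))))) ` singular_codes k t"
proof
  fix x assume "x \<in> singular_points k (cis t)"
  then have x: "x \<in> iterate_domain P S k" "snd x = cis t" "end_point P ((T ^^ k) x) \<in> corners S"
    by (auto simp: singular_points_def)
  \<comment> \<open>The reversed orbit starts at the corner that the orbit of \<open>x\<close> runs
    into.\<close>
  define y where "y = reversal ((T ^^ k) x)"
  note y = reversed_orbit[OF x(1), folded y_def]
  define c where "c = fst y"
  define \<phi> where "\<phi> = Arg (snd y)"
  have ny: "norm (snd y) = 1" using y(1) by (auto simp: reach_def phase_space_def)
  then have "snd y \<noteq> 0" by force
  then have yc: "y = (c, cis \<phi>)"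
    using cis_Arg[of "snd y"] ny by (simp add: c_def \<phi>_def sgn_eq prod_eq_iff)
  obtain \<rho> where \<rho>: "\<rho> \<in> slopes k" "snd ((T ^^ k) y) = \<rho> * cis ((-1) ^ k * \<phi>)"
    using direction_funpow y(1) unfolding yc by blast
  define \<psi> where "\<psi> = (-1) ^ k * (t + pi - Arg \<rho>)"
  have "\<rho> \<noteq> 0" using norm_slopes[OF \<rho>(1)] by force
  moreover from this have "\<rho> = cis (Arg \<rho>)"
    using norm_slopes[OF \<rho>(1)] cis_Arg[of \<rho>] by (simp add: sgn_eq)
  \<comment> \<open>Reversing the final segment of the orbit of \<open>y\<close> flips its
    direction, which is where \<open>pi\<close> in the code comes from.\<close>
  moreover have "cis t = - (\<rho> * cis ((-1) ^ k * \<phi>))"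
    using x(2) \<rho>(2) by (subst (asm) y(2)) simp
  moreover have "- cis t = cis (t + pi)" by (simp flip: cis_mult)
  ultimately have "cis ((-1) ^ k * \<phi>) = cis (t + pi) / cis (Arg \<rho>)"
    by (simp add: eq_divide_eq mult.commute)
  also have "\<dots> = cis (t + pi - Arg \<rho>)" by (rule cis_divide)
  finally have "cis ((-1) ^ k * \<phi>) = cis ((-1) ^ k * \<psi>)" by (simp add: \<psi>_def)
  \<comment> \<open>The angles themselves may differ by a multiple of \<open>2 * pi\<close>;
    agreement of \<open>cis\<close> suffices, and the sign \<open>(-1) ^ k\<close> is harmless for
    it.\<close>
  then have \<psi>: "cis \<phi> = cis \<psi>"
    by (cases "even k") (simp_all add: complex_eq_iff)
  then have "\<psi> \<in> emanating k c \<rho>"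
    using y(1) \<rho>(2) \<open>cis ((-1) ^ k * \<phi>) = cis ((-1) ^ k * \<psi>)\<close> by (simp add: emanating_def yc)
  moreover have "c \<in> corners S" using x(3) by (simp add: c_def y_def)
  ultimately have "(c, \<rho>) \<in> singular_codes k t" using \<rho>(1) by (simp add: singular_codes_def \<psi>_def)
  moreover have "x = reversal ((T ^^ k) (c, cis \<psi>))" using y(2) by (simp add: yc \<psi>)
  ultimately show "x \<in> (\<lambda>(c, \<rho>). reversal ((T ^^ k) (c, cis ((-1) ^ k * (t + pi - Arg \<rho>))))) ` singular_codes k t"
    unfolding \<psi>_def by force
qed

lemma
  shows finite_singular_points: "finite (singular_points k (cis t))"
    and card_singular_points: "card (singular_points k (cis t)) \<le> card (singular_codes k t)"
  using singular_points_subset finite_singular_codes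
  by (blast intro: finite_surj, metis surj_card_le)

section \<open>Counting regions by singular points\<close>

text \<open>The piece of the side between the two parameters lies in the domain, since a point
  outside it would be singular. Being connected, it lies in one component.\<close>

lemma same_region:
  fixes a b \<theta> :: complex
  defines "L \<equiv> \<lambda>y. (a + y *\<^sub>R (b - a), \<theta>)"
  assumes s: "(a, b) \<in> S" and xy: "0 < x" "x \<le> x'" "x' < 1"
    and C: "C \<in> continuity_regions P S n" "L x \<in> C"
    and C': "C' \<in> continuity_regions P S n" "L x' \<in> C'"
    and reg: "\<And>y. x < y \<Longrightarrow> y < x' \<Longrightarrow> L y \<notin> (\<Union>k<n. singular_points k \<theta>)"
  shows "C = C'"
proof -
  let ?D = "iterate_domain P S n"
  have CD: "C \<subseteq> ?D" "C' \<subseteq> ?D"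
    using C(1) C'(1) in_components_subset unfolding continuity_regions_def by blast+
  have os: "a + y *\<^sub>R (b - a) \<in> open_segment a b" if "0 < y" "y < 1" for y
    using that side_neq[OF s] unfolding in_segment by (intro conjI exI[of _ y]) (auto simp: algebra_simps)
  have Lx: "L x \<in> X" using C(2) CD(1) by (auto simp: iterate_domain_def)
  then have "norm \<theta> = 1" by (auto simp: phase_space_def L_def)
  have "Im (\<theta> / (b - a)) \<noteq> 0"
    using phase_space_transversal[OF s os] Lx xy by (simp add: L_def)
  then have LX: "L y \<in> X" if "0 < y" "y < 1" for y
    unfolding L_def
    using xy that
    by (intro phase_space_side[OF s os os Lx[unfolded L_def] \<open>norm \<theta> = 1\<close>])
      (auto simp: zero_less_mult_iff linorder_neq_iff)
  have LD: "L y \<in> ?D" if "x \<le> y" "y \<le> x'" for y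
  proof (rule ccontr)
    assume nD: "L y \<notin> ?D"
    then have "x < y" "y < x'" using that C(2) C'(2) CD by (auto simp: order.order_iff_strict)
    have nc: "fst (L y) \<notin> corners S"
      using open_side_not_corner[OF s os] xy that by (simp add: L_def)
    \<comment> \<open>The least \<open>k\<close> with this property is the step at which
      \<open>L y\<close> is singular.\<close>
    let ?Q = "\<lambda>k. k < n \<and> end_point P ((T ^^ k) (L y)) \<in> corners S"
    have "\<exists>k. ?Q k" using nD nc LX[of y] xy that by (auto simp: iterate_domain_def)
    then obtain k where k: "?Q k" "\<And>j. j < k \<Longrightarrow> \<not> ?Q j"
      using exists_least_iff[of ?Q] by blast
    then have "L y \<in> singular_points k \<theta>"
      using nc LX[of y] xy that
      by (auto simp: singular_points_def iterate_domain_def L_def)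
    then show False using reg[OF \<open>x < y\<close> \<open>y < x'\<close>] k(1) by blast
  qed
  have conn: "connected (L ` {x..x'})"
    unfolding L_def by (intro connected_continuous_image continuous_intros) auto
  have sub: "L ` {x..x'} \<subseteq> ?D" using LD by auto
  have ends: "L x \<in> L ` {x..x'}" "L x' \<in> L ` {x..x'}" using xy by auto
  have "L ` {x..x'} \<subseteq> C"
    using C ends unfolding continuity_regions_def by (intro components_maximal[OF _ conn sub]) blast+
  then have "C \<inter> C' \<noteq> {}" using C'(2) ends by blast
  then show "C = C'" using C(1) C'(1) components_nonoverlap unfolding continuity_regions_def by blast
qed

text \<open>Each region gets a representative on some side; the side together with the number of
  singular points before the representative determines the region.\<close>

lemma direction_regions_bound:
  fixes t n
  defines "E \<equiv> (\<Union>k<n. singular_points k (cis t))"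
  shows "finite (direction_regions P S (cis t) n)"
    and "direction_complexity P S (cis t) n \<le> card S * Suc (card E)"
proof -
  let ?R = "direction_regions P S (cis t) n"
  define L where "L = (\<lambda>(s :: complex \<times> complex) y. (fst s + y *\<^sub>R (snd s - fst s), cis t))"
  have finE: "finite E" by (simp add: E_def finite_singular_points)
  have inj: "inj_on (L s) A" if "s \<in> S" for s A
    using that side_neq[of "fst s" "snd s"] by (auto simp: L_def inj_on_def)
  have "\<exists>s y. s \<in> S \<and> 0 < y \<and> y < 1 \<and> L s y \<in> C" if CR: "C \<in> ?R" for C
  proof -
    have "C \<subseteq> iterate_domain P S n"
      using that in_components_subset by (auto simp: direction_regions_def continuity_regions_def)
    moreover obtain p where p: "(p, cis t) \<in> C"
      using CR by (auto simp: direction_regions_def direction_set_def)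
    ultimately have "p \<in> frontier P" "p \<notin> corners S"
      by (auto simp: iterate_domain_def phase_space_def)
    then obtain a b where ab: "(a, b) \<in> S" "p \<in> open_segment a b"
      by (rule frontier_not_corner)
    then obtain y where "0 < y" "y < 1" "p = a + y *\<^sub>R (b - a)"
      by (auto simp: in_segment algebra_simps)
    then show ?thesis using ab p by (intro exI[of _ "(a, b)"] exI[of _ y]) (simp add: L_def)
  qed
  then obtain \<sigma> \<eta> where rep:
    "\<And>C. C \<in> ?R \<Longrightarrow> \<sigma> C \<in> S \<and> 0 < \<eta> C \<and> \<eta> C < 1 \<and> L (\<sigma> C) (\<eta> C) \<in> C"
    by metis
  define B where "B = (\<lambda>s x. {y. y < x \<and> L s y \<in> E})"
  have finB: "finite (B s x)" "card (B s x) \<le> card E" if "s \<in> S" for s x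
  proof -
    have "L s ` B s x \<subseteq> E" by (auto simp: B_def)
    then show "finite (B s x)" "card (B s x) \<le> card E"
      using finE inj[OF that] by (auto intro: inj_on_finite card_inj_on_le)
  qed
  have eq: "C = C'" if C: "C \<in> ?R" "C' \<in> ?R" "\<sigma> C = \<sigma> C'" "\<eta> C \<le> \<eta> C'"
    and card: "card (B (\<sigma> C) (\<eta> C)) = card (B (\<sigma> C) (\<eta> C'))" for C C'
  proof -
    \<comment> \<open>The two finite sets are nested, so equal cardinality forces equality and no
      singular point separates the representatives.\<close>
    have eqB: "B (\<sigma> C) (\<eta> C) = B (\<sigma> C) (\<eta> C')"
      using card C(4) rep[OF C(1)] finB(1) by (intro card_subset_eq) (auto simp: B_def)
    have reg: "L (\<sigma> C) y \<notin> E" if "\<eta> C < y" "y < \<eta> C'" for y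
    proof
      assume "L (\<sigma> C) y \<in> E"
      then have "y \<in> B (\<sigma> C) (\<eta> C')" using that by (simp add: B_def)
      then show False using that unfolding eqB[symmetric] by (simp add: B_def)
    qed
    obtain a b where ab: "\<sigma> C = (a, b)" by fastforce
    show ?thesis
    proof (rule same_region[of a b "\<eta> C" "\<eta> C'" C n "cis t" C'])
      show "(a, b) \<in> S" "0 < \<eta> C" "\<eta> C' < 1" "(a + \<eta> C *\<^sub>R (b - a), cis t) \<in> C"
        "(a + \<eta> C' *\<^sub>R (b - a), cis t) \<in> C'"
        using rep[OF C(1)] rep[OF C(2)] unfolding C(3)[symmetric] by (simp_all add: L_def ab)
      show "C \<in> continuity_regions P S n" "C' \<in> continuity_regions P S n"
        using C(1,2) by (simp_all add: direction_regions_def)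
      show "(a + y *\<^sub>R (b - a), cis t) \<notin> (\<Union>k<n. singular_points k (cis t))"
        if "\<eta> C < y" "y < \<eta> C'" for y
        using reg[OF that] ab by (simp add: L_def E_def)
    qed (rule C(4))
  qed
  have inj_key: "inj_on (\<lambda>C. (\<sigma> C, card (B (\<sigma> C) (\<eta> C)))) ?R"
    using eq by (intro inj_onI) (metis linear prod.inject)
  \<comment> \<open>The count ranges over 0 to \<open>card E\<close>, whence the factor
    \<open>Suc (card E)\<close>.\<close>
  have sub: "(\<lambda>C. (\<sigma> C, card (B (\<sigma> C) (\<eta> C)))) ` ?R \<subseteq> S \<times> {..card E}"
    using rep finB(2) by (simp add: image_subset_iff)
  show "finite ?R" using inj_on_finite[OF inj_key sub] finite_S by simp
  show "direction_complexity P S (cis t) n \<le> card S * Suc (card E)"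
    using card_inj_on_le[OF inj_key sub] finite_S
    by (simp add: direction_complexity_def)
qed

lemma direction_complexity_le:
  "direction_complexity P S (cis t) n \<le> card S * Suc (\<Sum>k<n. card (singular_codes k t))"
proof -
  have "card (\<Union>k<n. singular_points k (cis t)) \<le> (\<Sum>k<n. card (singular_points k (cis t)))"
    by (rule card_UN_le) simp
  also have "\<dots> \<le> (\<Sum>k<n. card (singular_codes k t))"
    by (intro sum_mono card_singular_points)
  finally have "card S * Suc (card (\<Union>k<n. singular_points k (cis t)))
      \<le> card S * Suc (\<Sum>k<n. card (singular_codes k t))" by simp
  then show ?thesis using direction_regions_bound(2)[of t n] by linarith
qed

section \<open>Borel measurability of the billiard orbits\<close>

lemma measurable_fst_snd [measurable]:
  "(fst :: complex \<times> complex \<Rightarrow> complex) \<in> borel_measurable borel"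
  "(snd :: complex \<times> complex \<Rightarrow> complex) \<in> borel_measurable borel"
  by (intro borel_measurable_continuous_onI continuous_on_fst continuous_on_snd continuous_on_id)+

lemma phase_space_borel [measurable]: "X \<in> sets borel"
proof -
  \<comment> \<open>The rays that fail to be inside at some time in a compact window; windows with
    \<open>j\<close> growing exhaust a right neighbourhood of 0.\<close>
  define N where "N m j = {x::complex \<times> complex.
    \<exists>t\<in>{inverse (real (Suc j))..inverse (real (Suc m))}. fst x + t *\<^sub>R snd x \<in> - interior P}" for m j
  have "closed (N m j)" for m j unfolding N_def by (intro closed_ray_hits) auto
  then have [measurable]: "N m j \<in> sets borel" for m j by (rule borel_closed)
  have "(\<forall>\<^sub>F t in at_right 0. fst x + t *\<^sub>R snd x \<in> interior P) \<longleftrightarrow> (\<exists>m. \<forall>j. x \<notin> N m j)" for x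
  proof
    assume "\<forall>\<^sub>F t in at_right 0. fst x + t *\<^sub>R snd x \<in> interior P"
    then obtain b where b: "b > 0" "\<And>t. 0 < t \<Longrightarrow> t < b \<Longrightarrow> fst x + t *\<^sub>R snd x \<in> interior P"
      unfolding eventually_at_right_field by auto
    obtain m where m: "inverse (real (Suc m)) < b" using reals_Archimedean[OF b(1)] by blast
    have "x \<notin> N m j" for j
    proof
      assume "x \<in> N m j"
      then obtain t where t: "inverse (real (Suc j)) \<le> t" "t \<le> inverse (real (Suc m))"
        "fst x + t *\<^sub>R snd x \<notin> interior P" by (auto simp: N_def)
      have "0 < inverse (real (Suc j))" by simp
      then show False using b(2)[of t] m t by linarith
    qed
    then show "\<exists>m. \<forall>j. x \<notin> N m j" by blast
  next
    assume "\<exists>m. \<forall>j. x \<notin> N m j"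
    then obtain m where m: "\<And>j. x \<notin> N m j" by blast
    have "fst x + t *\<^sub>R snd x \<in> interior P" if t: "0 < t" "t < inverse (real (Suc m))" for t
    proof -
      obtain j where "inverse (real (Suc j)) < t" using reals_Archimedean[OF t(1)] by blast
      then show ?thesis using m[of j] t(2) by (simp add: N_def less_imp_le)
    qed
    moreover have "0 < inverse (real (Suc m))" by simp
    ultimately show "\<forall>\<^sub>F t in at_right 0. fst x + t *\<^sub>R snd x \<in> interior P"
      unfolding eventually_at_right_field by blast
  qed
  then have "X = {x. fst x \<in> frontier P \<and> norm (snd x) = 1 \<and> (\<exists>m. \<forall>j. x \<notin> N m j)}"
    by (simp add: phase_space_def case_prod_unfold)
  moreover have [measurable]: "frontier P \<in> sets borel" by (simp add: borel_closed)
  ultimately show ?thesis by simp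
qed

text \<open>The value 0 off \<open>X\<close> yields a Borel function on the whole space, as infima
  for arbitrary vectors are not controlled.\<close>

definition total_flight :: "complex \<times> complex \<Rightarrow> real" where
  "total_flight x = (if x \<in> X then flight x else 0)"

lemma total_flight_borel [measurable]: "total_flight \<in> borel_measurable borel"
proof (rule borel_measurableI_le)
  fix r :: real
  \<comment> \<open>The positive lower bound excludes the hit at time 0 while keeping the time
    interval compact.\<close>
  define N where "N j = {x::complex \<times> complex.
    \<exists>t\<in>{inverse (real (Suc j))..r}. fst x + t *\<^sub>R snd x \<in> frontier P}" for j
  have "closed (N j)" for j unfolding N_def by (intro closed_ray_hits) auto
  then have [measurable]: "N j \<in> sets borel" for j by (rule borel_closed)
  have "flight x \<le> r \<longleftrightarrow> (\<exists>j. x \<in> N j)" if x: "x \<in> X" for x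
  proof
    assume *: "flight x \<le> r"
    obtain j where "inverse (real (Suc j)) < flight x" using reals_Archimedean flight(1)[OF x] by blast
    then have "x \<in> N j"
      using * flight(2)[OF x] unfolding N_def end_point_flight by (auto intro!: bexI[of _ "flight x"])
    then show "\<exists>j. x \<in> N j" by blast
  next
    assume "\<exists>j. x \<in> N j"
    then obtain j t where t: "inverse (real (Suc j)) \<le> t" "t \<le> r" "fst x + t *\<^sub>R snd x \<in> frontier P"
      by (auto simp: N_def)
    have "0 < inverse (real (Suc j))" by simp
    then have "0 < t" using t(1) by linarith
    then have "\<not> t < flight x" using flight(3)[OF x, of t] t(3) by (auto simp: frontier_def)
    then show "flight x \<le> r" using t(2) by simp
  qed
  then have "{x \<in> space borel. total_flight x \<le> r} = {x. if x \<in> X then \<exists>j. x \<in> N j else 0 \<le> r}"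
    by (auto simp: total_flight_def)
  then show "{x \<in> space borel. total_flight x \<le> r} \<in> sets borel" by simp
qed

definition landing :: "complex \<times> complex \<Rightarrow> complex" where
  "landing x = fst x + total_flight x *\<^sub>R snd x"

lemma landing_borel [measurable]: "landing \<in> borel_measurable borel"
  unfolding landing_def by measurable

lemma landing_eq: "x \<in> X \<Longrightarrow> landing x = end_point P x"
  by (simp add: landing_def total_flight_def end_point_flight)

text \<open>A Borel substitute for \<open>T\<close>: at most one indicator is nonzero, so the sum
  selects the side without a definite description.\<close>

definition borel_step :: "complex \<times> complex \<Rightarrow> complex \<times> complex" where
  "borel_step x = (landing x, \<Sum>(a, b)\<in>S.
     indicator (open_segment a b) (landing x) *\<^sub>R ((b - a) / cnj (b - a) * cnj (snd x)))"

lemma borel_step_borel [measurable]: "borel_step \<in> borel_measurable borel"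
proof -
  have [measurable]: "open_segment a b \<in> sets borel" for a b :: complex
    by (simp add: open_segment_def borel_closed)
  have [measurable]: "cnj \<in> borel_measurable borel"
    by (intro borel_measurable_continuous_onI continuous_intros)
  show ?thesis unfolding borel_step_def case_prod_unfold by measurable
qed

lemma borel_step_eq:
  assumes x: "x \<in> X" "end_point P x \<notin> corners S"
  shows "borel_step x = T x"
proof -
  let ?q = "end_point P x"
  obtain a b where ab: "(a, b) \<in> S" "?q \<in> open_segment a b"
    using flight(2)[OF x(1)] x(2) by (rule frontier_not_corner)
  have "?q \<notin> open_segment (fst s) (snd s)" if "s \<in> S - {(a, b)}" for s
    using that ab sides_disjoint[of a b "fst s" "snd s"] open_closed_segment by fastforce
  then have "borel_step x = (?q, (b - a) / cnj (b - a) * cnj (snd x))"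
    unfolding borel_step_def case_prod_unfold landing_eq[OF x(1)]
    using ab finite_S by (subst sum.remove[of S "(a, b)"]) auto
  also have "\<dots> = T x"
    unfolding billiard_map_eq reversal_def by (simp add: bounce_side[OF ab])
  finally show ?thesis .
qed

lemma funpow_borel_step_borel [measurable]: "borel_step ^^ k \<in> borel_measurable borel"
  by (induction k) (auto simp: id_def intro: measurable_comp[OF _ borel_step_borel])

text \<open>Proved together because measurability of \<open>reach (Suc k)\<close> rests on the
  agreement of the iterates on \<open>reach k\<close>.\<close>

lemma
  shows reach_borel [measurable]: "reach k \<in> sets borel"
    and funpow_borel_step_eq: "x \<in> reach k \<Longrightarrow> (borel_step ^^ k) x = (T ^^ k) x"
proof -
  have "reach k \<in> sets borel \<and> (\<forall>x\<in>reach k. (borel_step ^^ k) x = (T ^^ k) x)"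
  proof (induction k)
    case 0
    have "reach 0 = X" by (simp add: reach_def)
    then show ?case by simp
  next
    case (Suc k)
    then have [measurable]: "reach k \<in> sets borel" by blast
    have eq: "(borel_step ^^ Suc k) x = (T ^^ Suc k) x" if "x \<in> reach (Suc k)" for x
      using Suc that by (simp add: reach_Suc funpow_phase_space borel_step_eq)
    have [measurable]: "corners S \<in> sets borel"
      by (intro borel_closed finite_imp_closed finite_corners)
    have "reach (Suc k) = {x \<in> reach k. landing ((borel_step ^^ k) x) \<notin> corners S}"
      using Suc by (auto simp: reach_Suc funpow_phase_space landing_eq)
    then have "reach (Suc k) \<in> sets borel" by simp
    then show ?case using eq by blast
  qed
  then show "reach k \<in> sets borel" "x \<in> reach k \<Longrightarrow> (borel_step ^^ k) x = (T ^^ k) x" by auto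
qed

lemma emanating_borel [measurable]: "emanating k c \<rho> \<in> sets borel"
proof -
  have [measurable]: "cis \<in> borel_measurable borel"
    by (intro borel_measurable_continuous_onI continuous_intros)
  have "emanating k c \<rho> = {\<phi>. (c, cis \<phi>) \<in> reach k \<and>
      snd ((borel_step ^^ k) (c, cis \<phi>)) = \<rho> * cis ((-1) ^ k * \<phi>)}"
    by (auto simp: emanating_def funpow_borel_step_eq)
  then show ?thesis by simp
qed

section \<open>Integrating the number of codes, and the growth bound\<close>

text \<open>The count becomes a finite sum of indicators composed with isometries of the line, which
  can be integrated termwise.\<close>

lemma card_singular_codes:
  "real (card (singular_codes k t)) =
    (\<Sum>c\<in>corners S. \<Sum>\<rho>\<in>slopes k. indicator (emanating k c \<rho>) ((-1) ^ k * (t + (pi - Arg \<rho>))))"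
proof -
  let ?Q = "\<lambda>p. (-1) ^ k * (t + (pi - Arg (snd p))) \<in> emanating k (fst p) (snd p)"
  have "singular_codes k t = (corners S \<times> slopes k) \<inter> {p. ?Q p}"
    by (auto simp: singular_codes_def algebra_simps)
  then have "real (card (singular_codes k t)) = (\<Sum>p\<in>corners S \<times> slopes k. of_bool (?Q p))"
    using finite_corners finite_slopes by simp
  also have "\<dots> = (\<Sum>c\<in>corners S. \<Sum>\<rho>\<in>slopes k. of_bool (?Q (c, \<rho>)))"
    by (subst sum.cartesian_product) (simp add: case_prod_unfold)
  finally show ?thesis by (simp add: indicator_def)
qed

text \<open>Along the rays emanating from a corner the map from initial to final direction is
  piecewise an isometry of the circle, so it preserves total measure on the disjoint pieces.\<close>

lemma nn_integral_singular_codes: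
  "(\<integral>\<^sup>+t. ennreal (real (card (singular_codes k t))) * indicator {-m..m} t \<partial>lborel)
    \<le> ennreal (real (card (corners S)) * (2 * (\<bar>m\<bar> + 7)))"
proof -
  \<comment> \<open>The constant 7 exceeds \<open>2 * pi\<close>, a bound for the shift
    \<open>pi - Arg \<rho>\<close>.\<close>
  let ?J = "{-(m + 7)..m + 7}"
  let ?f = "\<lambda>c \<rho> t. indicator (emanating k c \<rho>) ((-1) ^ k * (t + (pi - Arg \<rho>))) * indicator {-m..m} t :: ennreal"
  have "(\<integral>\<^sup>+t. ennreal (real (card (singular_codes k t))) * indicator {-m..m} t \<partial>lborel)
      = (\<integral>\<^sup>+t. (\<Sum>c\<in>corners S. \<Sum>\<rho>\<in>slopes k. ?f c \<rho> t) \<partial>lborel)"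
    unfolding card_singular_codes
    by (simp add: sum_nonneg sum_distrib_right ennreal_indicator flip: sum_ennreal)
  also have "\<dots> = (\<Sum>c\<in>corners S. \<Sum>\<rho>\<in>slopes k. \<integral>\<^sup>+t. ?f c \<rho> t \<partial>lborel)"
    by (simp add: nn_integral_sum)
  also have "\<dots> \<le> (\<Sum>c\<in>corners S. \<Sum>\<rho>\<in>slopes k. emeasure lborel (emanating k c \<rho> \<inter> ?J))"
  proof (intro sum_mono nn_integral_indicator_affine_le emanating_borel)
    fix \<rho> show "\<bar>pi - Arg \<rho>\<bar> \<le> 7"
      using Arg_bounded[of \<rho>] pi_less_4 pi_approx by (simp add: abs_le_iff)
  qed (simp add: power_abs)
  also have "\<dots> \<le> (\<Sum>c\<in>corners S. ennreal (2 * (\<bar>m\<bar> + 7)))"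
  proof (intro sum_mono)
    fix c
    \<comment> \<open>Disjointness bounds the sum by the length of one interval, however many slopes
      there are; this makes the bound independent of \<open>k\<close>.\<close>
    have "disjoint_family_on (\<lambda>\<rho>. emanating k c \<rho> \<inter> ?J) (slopes k)"
      by (auto simp: disjoint_family_on_def emanating_def)
    then have "(\<Sum>\<rho>\<in>slopes k. emeasure lborel (emanating k c \<rho> \<inter> ?J))
        = emeasure lborel (\<Union>\<rho>\<in>slopes k. emanating k c \<rho> \<inter> ?J)"
      by (intro sum_emeasure) (auto simp: finite_slopes)
    also have "\<dots> \<le> emeasure lborel ?J" by (intro emeasure_mono) auto
    also have "\<dots> \<le> ennreal (2 * (\<bar>m\<bar> + 7))"
      unfolding emeasure_lborel_Icc_eq by (simp add: ennreal_leI abs_ge_self del: ennreal_plus)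
    finally show "(\<Sum>\<rho>\<in>slopes k. emeasure lborel (emanating k c \<rho> \<inter> ?J)) \<le> ennreal (2 * (\<bar>m\<bar> + 7))" .
  qed
  also have "\<dots> = ennreal (real (card (corners S)) * (2 * (\<bar>m\<bar> + 7)))"
    by (simp add: ennreal_mult ennreal_of_nat_eq_real_of_nat)
  finally show ?thesis .
qed

lemma AE_direction_complexity_bigo:
  assumes \<epsilon>: "\<epsilon> > 0"
  shows "AE t in lborel.
    (\<lambda>n. real (direction_complexity P S (cis t) n)) \<in> O(\<lambda>n. real n powr (1 + \<epsilon>))"
proof -
  have "(\<lambda>t. real (card (singular_codes k t))) \<in> borel_measurable borel" for k
    unfolding card_singular_codes by measurable
  then have "AE t in lborel. \<exists>K\<ge>0. \<forall>n. (\<Sum>k<n. real (card (singular_codes k t))) \<le> K * real n powr (1 + \<epsilon>)"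
    by (intro AE_partial_sums_powr[OF \<epsilon>, where c = "\<lambda>m. real (card (corners S)) * (2 * (\<bar>m\<bar> + 7))"]
        nn_integral_singular_codes) auto
  then show ?thesis
  proof eventually_elim
    case (elim t)
    then obtain K where K: "K \<ge> 0"
      "\<And>n. (\<Sum>k<n. real (card (singular_codes k t))) \<le> K * real n powr (1 + \<epsilon>)" by blast
    have "norm (real (direction_complexity P S (cis t) n))
        \<le> (real (card S) * (1 + K)) * norm (real n powr (1 + \<epsilon>))" if n: "n \<ge> 1" for n
    proof -
      \<comment> \<open>For \<open>n \<ge> 1\<close> the additive 1 coming from \<open>Suc\<close>
        is absorbed into the power of \<open>n\<close>.\<close>
      have "1 \<le> real n powr (1 + \<epsilon>)" using n \<epsilon> by (intro ge_one_powr_ge_zero) auto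
      then have "1 + (\<Sum>k<n. real (card (singular_codes k t))) \<le> (1 + K) * real n powr (1 + \<epsilon>)"
        using K(2)[of n] by (simp add: algebra_simps)
      then have "real (card S) * (1 + (\<Sum>k<n. real (card (singular_codes k t))))
          \<le> real (card S) * ((1 + K) * real n powr (1 + \<epsilon>))"
        by (intro mult_left_mono) auto
      moreover have "real (direction_complexity P S (cis t) n)
          \<le> real (card S * Suc (\<Sum>k<n. card (singular_codes k t)))"
        using direction_complexity_le of_nat_le_iff by blast
      ultimately show ?thesis by (simp add: algebra_simps)
    qed
    then show ?case
      by (intro bigoI[where c = "real (card S) * (1 + K)"] eventually_sequentiallyI[of 1])
  qed
qed

end

text \<open>Directions are parametrized by their angle. Finiteness is asserted because
  \<open>card\<close> is 0 on infinite sets, so the bound speaks of a genuine count.\<close>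

theorem corollary6:
  fixes P :: "complex set" and S :: "(complex \<times> complex) set" and \<epsilon> :: real
  assumes "polygon P S" and "\<epsilon> > 0"
  shows "AE t in lborel.
    (\<forall>n. finite (direction_regions P S (cis t) n)) \<and>
    (\<lambda>n. real (direction_complexity P S (cis t) n)) \<in> O(\<lambda>n. real n powr (1 + \<epsilon>))"
proof -
  interpret polygon_table P S by standard (rule assms(1))
  from AE_direction_complexity_bigo[OF assms(2)] show ?thesis
    by eventually_elim (simp add: direction_regions_bound(1))
qed

end
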